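(* Let $G$ be a connected $\mathcal{E}$-transmission regular graph with $\mathcal{E}$-transmission degree $k$, and let $k=\xi_1\geq\xi_2\geq\dots\geq\xi_n$ be the eigenvalues (with multiplicity) of $\mathcal{E}(G)$. Then the eigenvalues of $\mathcal{E}^{\mathcal{L}}(G)$, with multiplicity, are $k-\xi_n\geq k-\xi_{n-1}\geq\dots\geq k-\xi_1=0$, and the eigenvalues of $\mathcal{E}^{\mathcal{Q}}(G)$, with multiplicity, are $2k\geq k+\xi_2\geq\dots\geq k+\xi_n$.
   Context: Graphs are finite, simple and undirected. For a connected graph $G$ with vertices $v_1,\dots,v_n$, $d(v_i,v_j)$ is the length of a shortest path and $e(v_i)=\max_j d(v_i,v_j)$ is the eccentricity. The eccentricity matrix $\mathcal{E}(G)$ is the symmetric $n\times n$ matrix with entries $\mathcal{E}_{ij}(G)=d(v_i,v_j)$ if $d(v_i,v_j)=\min\{e(v_i),e(v_j)\}$ and $\mathcal{E}_{ij}(G)=0$ if $d(v_i,v_j)<\min\{e(v_i),e(v_j)\}$. The $\mathcal{E}$-transmission of $v_i$ is $\mathrm{Tr}_{\mathcal{E}}(v_i)=\sum_j \mathcal{E}_{ij}(G)$, and $\mathrm{Diag}(\mathrm{Tr}_{\mathcal{E}}(G))$ is the diagonal matrix of these numbers. The eccentricity Laplacian is $\mathcal{E}^{\mathcal{L}}(G)=\mathrm{Diag}(\mathrm{Tr}_{\mathcal{E}}(G))-\mathcal{E}(G)$ and the eccentricity signless Laplacian is $\mathcal{E}^{\mathcal{Q}}(G)=\mathrm{Diag}(\mathrm{Tr}_{\mathcal{E}}(G))+\mathcal{E}(G)$.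 $G$ is $\mathcal{E}$-transmission regular with $\mathcal{E}$-transmission degree $k$ if $\mathrm{Tr}_{\mathcal{E}}(v_i)=k$ for every vertex $v_i$. *)

theory Defs
  imports
    "Graph_Theory.Digraph_Component"
    "Jordan_Normal_Form.Char_Poly"
begin

text \<open>
  Finite simple undirected graphs are represented by the locale \<^locale>\<open>graph\<close>: an undirected
  edge is a pair of opposite arcs, so the number of arcs of a path is its usual length.
  The vertex list \<open>vs\<close> below stands for the enumeration \<open>v\<^sub>1, \<dots>, v\<^sub>n\<close> that fixes the order of the
  rows and columns of the matrices.
\<close>

definition distance :: "('a, 'b) pre_digraph \<Rightarrow> 'a \<Rightarrow> 'a \<Rightarrow> nat" where
  "distance G u v = (LEAST l. \<exists>p. pre_digraph.apath G u p v \<and> length p = l)"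

definition eccentricity :: "('a, 'b) pre_digraph \<Rightarrow> 'a \<Rightarrow> nat" where
  "eccentricity G u = Max (distance G u ` verts G)"

definition ecc_entry :: "('a, 'b) pre_digraph \<Rightarrow> 'a \<Rightarrow> 'a \<Rightarrow> real" where
  "ecc_entry G u v =
    (if distance G u v = min (eccentricity G u) (eccentricity G v)
     then real (distance G u v) else 0)"

definition ecc_transmission :: "('a, 'b) pre_digraph \<Rightarrow> 'a \<Rightarrow> real" where
  "ecc_transmission G u = (\<Sum>v\<in>verts G. ecc_entry G u v)"

definition ecc_transmission_regular :: "('a, 'b) pre_digraph \<Rightarrow> real \<Rightarrow> bool" where
  "ecc_transmission_regular G k \<longleftrightarrow> (\<forall>u\<in>verts G. ecc_transmission G u = k)"

definition vertex_enumeration :: "('a, 'b) pre_digraph \<Rightarrow> 'a list \<Rightarrow> bool" where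
  "vertex_enumeration G vs \<longleftrightarrow> distinct vs \<and> set vs = verts G"

definition ecc_matrix :: "('a, 'b) pre_digraph \<Rightarrow> 'a list \<Rightarrow> real mat" where
  "ecc_matrix G vs =
    Matrix.mat (length vs) (length vs) (\<lambda>(i, j). ecc_entry G (vs ! i) (vs ! j))"

definition ecc_transmission_diag :: "('a, 'b) pre_digraph \<Rightarrow> 'a list \<Rightarrow> real mat" where
  "ecc_transmission_diag G vs = mat_diag (length vs) (\<lambda>i. ecc_transmission G (vs ! i))"

definition ecc_laplacian :: "('a, 'b) pre_digraph \<Rightarrow> 'a list \<Rightarrow> real mat" where
  "ecc_laplacian G vs = ecc_transmission_diag G vs - ecc_matrix G vs"

definition ecc_signless_laplacian :: "('a, 'b) pre_digraph \<Rightarrow> 'a list \<Rightarrow> real mat" where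
  "ecc_signless_laplacian G vs = ecc_transmission_diag G vs + ecc_matrix G vs"

text \<open>
  Only the real eigenvalues are collected, each with its algebraic multiplicity. For an
  \<open>n \<times> n\<close> matrix these are all the eigenvalues precisely when the multiset has \<open>n\<close> elements.
\<close>

definition eigenvalue_mset :: "real mat \<Rightarrow> real multiset" where
  "eigenvalue_mset A = proots (char_poly A)"

end

theory Submission
  imports Defs "Jordan_Normal_Form.Schur_Decomposition"
begin

text \<open>
  For an \<open>\<E>\<close>-transmission regular graph the transmission diagonal is the scalar matrix \<open>k I\<close>, so the
  two Laplacians are \<open>k I - \<E>\<close> and \<open>k I + \<E>\<close>. The map \<open>\<E> \<mapsto> k I + c \<E>\<close> moves every eigenvalue
  \<open>\<xi>\<close> to \<open>k + c \<xi>\<close> and keeps algebraic multiplicities (\<open>eigenvalue_mset_affine\<close>): triangularising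
  \<open>\<E>\<close> by a similarity triangularises \<open>k I + c \<E>\<close> by the same similarity.

  What remains is that the list \<open>\<xi>\<close> is complete and starts with \<open>k\<close>. It is complete because
  distances in an undirected graph are symmetric, whence \<open>\<E>\<close> is a real symmetric matrix and its
  characteristic polynomial splits over the reals (\<open>symmetric_char_poly_splits\<close>). Regularity says
  that all rows of \<open>\<E>\<close> have sum \<open>k\<close>, so \<open>k\<close> is an eigenvalue with the all-ones eigenvector; since
  the entries of \<open>\<E>\<close> are nonnegative, no eigenvalue exceeds this row sum
  (\<open>eigenvalue_le_row_sum\<close>), and \<open>k\<close> is the first entry of the decreasing list.
\<close>

section \<open>Symmetry of the eccentricity matrix\<close>

text \<open>
  Arcs are directed, so reversing a path means replacing each arc by an opposite one. That the
  vertex sets agree is carried along because the induction needs it: the vertex appended to the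
  reversed path must be new there as it was in the original.
\<close>

lemma (in sym_digraph) apath_reverse:
  assumes "apath u p v"
  shows "\<exists>q. apath v q u \<and> length q = length p \<and> set (awalk_verts v q) = set (awalk_verts u p)"
  using assms
proof (induction p arbitrary: u)
  case Nil
  then show ?case by (auto simp: apath_Nil_iff intro!: exI[of _ "[]"])
next
  case (Cons e p)
  then have e: "e \<in> arcs G" "tail G e = u"
    and p: "apath (head G e) p v" and new: "u \<notin> set (awalk_verts (head G e) p)"
    by (auto simp: apath_Cons_iff)
  obtain q where q: "apath v q (head G e)" "length q = length p"
      "set (awalk_verts v q) = set (awalk_verts (head G e) p)"
    using Cons.IH[OF p] by blast
  obtain f where f: "f \<in> arcs G" "tail G f = head G e" "head G f = u"
    using sym_arcs e unfolding symmetric_conv by metis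
  have last: "awlast v q = head G e"
    using awalk_ends q(1) unfolding apath_def by blast
  have "u \<noteq> head G e"
    using new hd_in_awalk_verts(2)[OF p] by auto
  moreover have "u \<in> verts G"
    using e by auto
  ultimately have f_path: "apath (head G e) [f] u"
    using f by (auto simp: apath_simps)
  have verts: "awalk_verts v (q @ [f]) = awalk_verts v q @ [u]"
    using f last by (cases "q = []") (auto simp: awalk_verts_conv)
  have "awalk v (q @ [f]) u"
    using q(1) f_path unfolding apath_def by auto
  then have "apath v (q @ [f]) u"
    using q(1,3) new unfolding apath_def verts by auto
  then show ?case
    using q(2,3) verts e by (intro exI[of _ "q @ [f]"]) auto
qed

lemma (in sym_digraph) distance_commute: "distance G u v = distance G v u"
proof -
  have "(\<exists>p. apath u p v \<and> length p = l) \<longleftrightarrow> (\<exists>p. apath v p u \<and> length p = l)" for l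
    using apath_reverse by metis
  then show ?thesis
    unfolding distance_def by simp
qed

lemma (in sym_digraph) ecc_entry_commute: "ecc_entry G u v = ecc_entry G v u"
  unfolding ecc_entry_def by (simp add: distance_commute[of u v] min.commute)

lemma ecc_matrix_carrier: "ecc_matrix G vs \<in> carrier_mat (length vs) (length vs)"
  by (simp add: ecc_matrix_def)

lemma ecc_matrix_row_sum:
  assumes "vertex_enumeration G vs" and "i < length vs"
  shows "(\<Sum>j<length vs. ecc_matrix G vs $$ (i, j)) = ecc_transmission G (vs ! i)"
proof -
  have "bij_betw ((!) vs) {..<length vs} (verts G)"
    using assms(1) bij_betw_nth unfolding vertex_enumeration_def by blast
  then show ?thesis
    unfolding ecc_transmission_def using assms(2)
    by (simp add: ecc_matrix_def sum.reindex_bij_betw)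
qed

section \<open>Spectra of real symmetric matrices\<close>

text \<open>
  For an eigenvector \<open>v\<close> the quadratic form \<open>v\<^sup>* A v\<close> equals \<open>z \<parallel>v\<parallel>\<^sup>2\<close>, and symmetry of the real matrix
  makes it equal to its own conjugate.
\<close>

lemma symmetric_real_eigenvalue_real:
  fixes A :: "real mat" and z :: complex
  assumes A: "A \<in> carrier_mat n n"
    and sym: "\<And>i j. i < n \<Longrightarrow> j < n \<Longrightarrow> A $$ (i, j) = A $$ (j, i)"
    and ev: "eigenvalue (map_mat complex_of_real A) z"
  shows "z \<in> \<real>"
proof -
  obtain v where v: "v \<in> carrier_vec n" "v \<noteq> 0\<^sub>v n"
      "map_mat complex_of_real A *\<^sub>v v = z \<cdot>\<^sub>v v"
    using ev A unfolding eigenvalue_def eigenvector_def by auto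
  have row: "(\<Sum>j<n. complex_of_real (A $$ (i, j)) * v $ j) = z * v $ i" if "i < n" for i
  proof -
    have "(map_mat complex_of_real A *\<^sub>v v) $ i = z * v $ i"
      using v that by simp
    then show ?thesis
      using A v(1) that by (simp add: scalar_prod_def lessThan_atLeast0)
  qed
  define S where "S = (\<Sum>i<n. \<Sum>j<n. cnj (v $ i) * (complex_of_real (A $$ (i, j)) * v $ j))"
  define N where "N = (\<Sum>i<n. (cmod (v $ i))\<^sup>2)"
  have "S = (\<Sum>i<n. cnj (v $ i) * (z * v $ i))"
    unfolding S_def by (rule sum.cong) (auto simp: sum_distrib_left[symmetric] row)
  also have "\<dots> = z * of_real N"
    unfolding N_def of_real_sum sum_distrib_left
    by (rule sum.cong) (auto simp: complex_norm_square simp del: of_real_power)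
  finally have S: "S = z * of_real N" .
  have "cnj S = (\<Sum>i<n. \<Sum>j<n. cnj (v $ j) * (complex_of_real (A $$ (j, i)) * v $ i))"
    unfolding S_def cnj_sum by (intro sum.cong refl) (auto simp: sym)
  also have "\<dots> = S"
    unfolding S_def by (rule sum.swap)
  finally have "cnj z * of_real N = z * of_real N"
    using S by simp
  moreover obtain i where "i < n" "v $ i \<noteq> 0"
    using v by (metis carrier_vecD eq_vecI index_zero_vec(1) index_zero_vec(2))
  then have "N \<noteq> 0"
    unfolding N_def by (subst sum_nonneg_eq_0_iff) auto
  ultimately show ?thesis
    by (simp add: Reals_cnj_iff)
qed

text \<open>
  The complex linear factorisation has only real roots, and it descends to the reals because
  the embedding of real into complex polynomials is injective.
\<close>

lemma symmetric_char_poly_splits: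
  fixes A :: "real mat"
  assumes A: "A \<in> carrier_mat n n"
    and sym: "\<And>i j. i < n \<Longrightarrow> j < n \<Longrightarrow> A $$ (i, j) = A $$ (j, i)"
  obtains es where "char_poly A = (\<Prod>e\<leftarrow>es. [:- e, 1:])" and "length es = n"
proof -
  let ?C = "map_mat complex_of_real A"
  have C: "?C \<in> carrier_mat n n"
    using A by simp
  obtain zs where zs: "char_poly ?C = (\<Prod>z\<leftarrow>zs. [:- z, 1:])" "length zs = n"
    using char_poly_factorized[OF C] by blast
  have "z \<in> \<real>" if "z \<in> set zs" for z
  proof (rule symmetric_real_eigenvalue_real[OF A sym])
    show "eigenvalue ?C z"
      using that unfolding eigenvalue_root_char_poly[OF C] zs(1)
      by (force simp: poly_prod_list prod_list_zero_iff)
  qed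
  then have real: "complex_of_real (Re z) = z" if "z \<in> set zs" for z
    using that by simp
  interpret p: map_poly_inj_comm_ring_hom complex_of_real ..
  have "map_poly complex_of_real (char_poly A) = char_poly ?C"
    by (rule of_real_hom.char_poly_hom[OF A, symmetric])
  also have "\<dots> = map_poly complex_of_real (\<Prod>e\<leftarrow>map Re zs. [:- e, 1:])"
    unfolding zs(1) p.hom_prod_list map_map
    by (intro arg_cong[where f = prod_list] map_cong) (auto simp: real)
  finally have "char_poly A = (\<Prod>e\<leftarrow>map Re zs. [:- e, 1:])"
    by (rule p.injectivity)
  then show ?thesis
    using that[of "map Re zs"] zs(2) by simp
qed

lemma eigenvalue_mset_of_linear_factors:
  assumes "char_poly A = (\<Prod>e\<leftarrow>es. [:- e, 1:])"
  shows "eigenvalue_mset A = mset es"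
proof -
  have "proots (\<Prod>e\<leftarrow>es. [:- e, 1:]) = mset es"
  proof (induction es)
    case (Cons e es)
    moreover have "(\<Prod>e\<leftarrow>es. [:- e, 1:]) \<noteq> 0"
      by (auto simp: prod_list_zero_iff)
    ultimately show ?case
      by (simp add: proots_mult del: mult_pCons_left)
  qed simp
  then show ?thesis
    using assms by (simp add: eigenvalue_mset_def)
qed

text \<open>
  With \<open>A = P B P\<inverse>\<close> for an upper triangular \<open>B\<close> whose diagonal lists the roots, the matrix
  \<open>k I + c A = P (k I + c B) P\<inverse>\<close> is similar to an upper triangular matrix with diagonal entries
  \<open>k + c e\<close>.
\<close>

lemma char_poly_affine:
  fixes A :: "real mat"
  assumes A: "A \<in> carrier_mat n n"
    and es: "char_poly A = (\<Prod>e\<leftarrow>es. [:- e, 1:])"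
  shows "char_poly (k \<cdot>\<^sub>m 1\<^sub>m n + c \<cdot>\<^sub>m A) = (\<Prod>e\<leftarrow>map (\<lambda>x. k + c * x) es. [:- e, 1:])"
proof -
  obtain B P Q where "schur_decomposition A es = (B, P, Q)"
    by (cases "schur_decomposition A es")
  then have wit: "similar_mat_wit A B P Q" and ut: "upper_triangular B" and diag: "diag_mat B = es"
    using schur_decomposition[OF A es] by auto
  note sim = similar_mat_witD2[OF A wit]
  note [simp] = sim(5-7) mult_carrier_mat[OF sim(6,5)] carrier_matD[OF sim(5)]
  let ?B = "k \<cdot>\<^sub>m 1\<^sub>m n + c \<cdot>\<^sub>m B"
  have "P * ?B * Q = (k \<cdot>\<^sub>m P + c \<cdot>\<^sub>m (P * B)) * Q"
    by (simp add: mult_add_distrib_mat[of _ n n _ n] mult_smult_distrib[of _ n n _ n]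
        right_mult_one_mat[of _ n n])
  also have "\<dots> = k \<cdot>\<^sub>m (P * Q) + c \<cdot>\<^sub>m (P * B * Q)"
    by (simp add: add_mult_distrib_mat[of _ n n _ _ n] mult_smult_assoc_mat[of _ n n _ n])
  finally have conj: "k \<cdot>\<^sub>m 1\<^sub>m n + c \<cdot>\<^sub>m A = P * ?B * Q"
    unfolding sim(1) sim(3)[symmetric] by (rule sym)
  have "{k \<cdot>\<^sub>m 1\<^sub>m n + c \<cdot>\<^sub>m A, ?B, P, Q} \<subseteq> carrier_mat n n"
    using A by simp
  then have "similar_mat (k \<cdot>\<^sub>m 1\<^sub>m n + c \<cdot>\<^sub>m A) ?B"
    by (rule similar_matI[OF _ sim(1,2) conj])
  then have "char_poly (k \<cdot>\<^sub>m 1\<^sub>m n + c \<cdot>\<^sub>m A) = char_poly ?B"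
    by (rule char_poly_similar)
  also have "\<dots> = (\<Prod>e\<leftarrow>diag_mat ?B. [:- e, 1:])"
    using ut by (intro char_poly_upper_triangular[of _ n]) (auto simp: upper_triangular_def)
  also have "diag_mat ?B = map (\<lambda>x. k + c * x) es"
    unfolding diag[symmetric] diag_mat_def by auto
  finally show ?thesis .
qed

lemma eigenvalue_mset_affine:
  fixes A :: "real mat"
  assumes A: "A \<in> carrier_mat n n"
    and sym: "\<And>i j. i < n \<Longrightarrow> j < n \<Longrightarrow> A $$ (i, j) = A $$ (j, i)"
  shows "eigenvalue_mset (k \<cdot>\<^sub>m 1\<^sub>m n + c \<cdot>\<^sub>m A) = image_mset (\<lambda>x. k + c * x) (eigenvalue_mset A)"
proof -
  obtain es where es: "char_poly A = (\<Prod>e\<leftarrow>es. [:- e, 1:])"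
    using symmetric_char_poly_splits[OF A sym] by blast
  show ?thesis
    unfolding eigenvalue_mset_of_linear_factors[OF es]
      eigenvalue_mset_of_linear_factors[OF char_poly_affine[OF A es]] by simp
qed

lemma size_eigenvalue_mset_symmetric:
  fixes A :: "real mat"
  assumes A: "A \<in> carrier_mat n n"
    and sym: "\<And>i j. i < n \<Longrightarrow> j < n \<Longrightarrow> A $$ (i, j) = A $$ (j, i)"
  shows "size (eigenvalue_mset A) = n"
proof -
  obtain es where "char_poly A = (\<Prod>e\<leftarrow>es. [:- e, 1:])" "length es = n"
    using symmetric_char_poly_splits[OF A sym] by blast
  then show ?thesis
    using eigenvalue_mset_of_linear_factors by simp
qed

lemma in_eigenvalue_mset_iff:
  assumes A: "A \<in> carrier_mat n n"
  shows "x \<in># eigenvalue_mset A \<longleftrightarrow> eigenvalue A x"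
proof -
  have "char_poly A \<noteq> 0"
    using degree_monic_char_poly[OF A] by auto
  then show ?thesis
    by (simp add: eigenvalue_mset_def eigenvalue_root_char_poly[OF A])
qed

section \<open>Matrices with constant row sums\<close>

lemma eigenvalue_row_sum:
  fixes A :: "real mat"
  assumes A: "A \<in> carrier_mat n n" and n: "0 < n"
    and row: "\<And>i. i < n \<Longrightarrow> (\<Sum>j<n. A $$ (i, j)) = k"
  shows "eigenvalue A k"
proof -
  let ?v = "Matrix.vec n (\<lambda>_. 1 :: real)"
  have "A *\<^sub>v ?v = k \<cdot>\<^sub>v ?v"
    using A row by (intro eq_vecI) (auto simp: scalar_prod_def lessThan_atLeast0)
  moreover have "?v \<noteq> 0\<^sub>v n"
    using n by (metis index_vec index_zero_vec(1) zero_neq_one)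
  ultimately have "eigenvector A ?v k"
    using A by (auto simp: eigenvector_def)
  then show ?thesis
    unfolding eigenvalue_def by blast
qed

text \<open>
  In the row of a coordinate of \<open>v\<close> of largest modulus, every \<open>v\<^sub>j\<close> is bounded by that coordinate,
  so the eigenvalue equation gives \<open>\<bar>x\<bar> \<bar>v\<^sub>i\<bar> \<le> k \<bar>v\<^sub>i\<bar>\<close>.
\<close>

lemma eigenvalue_le_row_sum:
  fixes A :: "real mat"
  assumes A: "A \<in> carrier_mat n n"
    and nonneg: "\<And>i j. i < n \<Longrightarrow> j < n \<Longrightarrow> 0 \<le> A $$ (i, j)"
    and row: "\<And>i. i < n \<Longrightarrow> (\<Sum>j<n. A $$ (i, j)) = k"
    and ev: "eigenvalue A x"
  shows "x \<le> k"
proof -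
  obtain v where v: "v \<in> carrier_vec n" "v \<noteq> 0\<^sub>v n" "A *\<^sub>v v = x \<cdot>\<^sub>v v"
    using ev A unfolding eigenvalue_def eigenvector_def by auto
  obtain l where l: "l < n" "v $ l \<noteq> 0"
    using v by (metis carrier_vecD eq_vecI index_zero_vec(1) index_zero_vec(2))
  obtain i where i: "i < n" and max: "\<And>j. j < n \<Longrightarrow> \<bar>v $ j\<bar> \<le> \<bar>v $ i\<bar>"
  proof -
    let ?M = "(\<lambda>j. \<bar>v $ j\<bar>) ` {..<n}"
    have "Max ?M \<in> ?M"
      using l(1) by (intro Max_in) auto
    moreover have "\<bar>v $ j\<bar> \<le> Max ?M" if "j < n" for j
      using that by simp
    ultimately show ?thesis
      using that by fastforce
  qed
  have pos: "0 < \<bar>v $ i\<bar>"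
    using max[OF l(1)] l(2) by linarith
  have "(A *\<^sub>v v) $ i = x * v $ i"
    using v i by simp
  then have "x * v $ i = (\<Sum>j<n. A $$ (i, j) * v $ j)"
    using A v(1) i by (simp add: scalar_prod_def lessThan_atLeast0)
  then have "\<bar>x\<bar> * \<bar>v $ i\<bar> = \<bar>\<Sum>j<n. A $$ (i, j) * v $ j\<bar>"
    by (metis abs_mult)
  also have "\<dots> \<le> (\<Sum>j<n. A $$ (i, j) * \<bar>v $ i\<bar>)"
    using i nonneg max
    by (intro order.trans[OF sum_abs] sum_mono) (auto simp: abs_mult intro!: mult_left_mono)
  also have "\<dots> = k * \<bar>v $ i\<bar>"
    by (simp add: sum_distrib_right[symmetric] row i)
  finally show ?thesis
    using pos by simp
qed

section \<open>Spectra of the eccentricity Laplacians\<close>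

theorem mainTheorem2:
  fixes G :: "('a, 'b) pre_digraph" and vs :: "'a list" and k :: real and \<xi> :: "real list"
  assumes "graph G"
    and "Digraph_Component.connected G"
    and "vertex_enumeration G vs"
    and "ecc_transmission_regular G k"
    and "mset \<xi> = eigenvalue_mset (ecc_matrix G vs)"
    and "sorted_wrt (\<ge>) \<xi>"
  shows "length \<xi> = card (verts G) \<and>
    hd \<xi> = k \<and>
    eigenvalue_mset (ecc_laplacian G vs) = mset (map (\<lambda>x. k - x) (rev \<xi>)) \<and>
    sorted_wrt (\<ge>) (map (\<lambda>x. k - x) (rev \<xi>)) \<and>
    last (map (\<lambda>x. k - x) (rev \<xi>)) = 0 \<and>
    eigenvalue_mset (ecc_signless_laplacian G vs) = mset (2 * k # map (\<lambda>x. k + x) (tl \<xi>)) \<and>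
    sorted_wrt (\<ge>) (2 * k # map (\<lambda>x. k + x) (tl \<xi>))"
proof -
  interpret graph G by fact
  let ?n = "length vs" and ?A = "ecc_matrix G vs"
  have vs: "distinct vs" "set vs = verts G"
    using assms(3) by (auto simp: vertex_enumeration_def)
  then have card: "?n = card (verts G)"
    by (metis distinct_card)
  have "verts G \<noteq> {}"
    using assms(2) by (simp add: connected_def strongly_connected_def)
  then have n: "0 < ?n"
    using vs by auto
  have A: "?A \<in> carrier_mat ?n ?n"
    by (rule ecc_matrix_carrier)
  have sym: "?A $$ (i, j) = ?A $$ (j, i)" if "i < ?n" "j < ?n" for i j
    using that ecc_entry_commute by (simp add: ecc_matrix_def)
  have nonneg: "0 \<le> ?A $$ (i, j)" if "i < ?n" "j < ?n" for i j
    using that by (simp add: ecc_matrix_def ecc_entry_def)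
  have transmission: "ecc_transmission G (vs ! i) = k" if "i < ?n" for i
    using assms(4) vs(2) that nth_mem unfolding ecc_transmission_regular_def by blast
  have row: "(\<Sum>j<?n. ?A $$ (i, j)) = k" if "i < ?n" for i
    using ecc_matrix_row_sum[OF assms(3) that] transmission[OF that] by simp

  have len: "length \<xi> = ?n"
    using size_eigenvalue_mset_symmetric[OF A sym] assms(5) by (metis size_mset)
  then have ne: "\<xi> \<noteq> []"
    using n by auto
  have elems: "x \<in> set \<xi> \<longleftrightarrow> eigenvalue ?A x" for x
    using in_eigenvalue_mset_iff[OF A] assms(5) by (metis set_mset_mset)
  have "k \<in> set \<xi>"
    using elems eigenvalue_row_sum[OF A n row] by blast
  then have "k \<le> hd \<xi>"
    using assms(6) by (cases \<xi>) auto
  moreover have "hd \<xi> \<le> k"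
    using eigenvalue_le_row_sum[OF A nonneg row] elems hd_in_set[OF ne] by simp
  ultimately have hd: "hd \<xi> = k"
    by simp

  have diag: "ecc_transmission_diag G vs = k \<cdot>\<^sub>m 1\<^sub>m ?n"
    by (rule eq_matI) (auto simp: ecc_transmission_diag_def mat_diag_def transmission)
  have "ecc_laplacian G vs = k \<cdot>\<^sub>m 1\<^sub>m ?n + (- 1) \<cdot>\<^sub>m ?A"
    unfolding ecc_laplacian_def diag using A by (intro eq_matI) auto
  then have laplacian: "eigenvalue_mset (ecc_laplacian G vs) = mset (map (\<lambda>x. k - x) (rev \<xi>))"
    using eigenvalue_mset_affine[OF A sym, of k "- 1"] assms(5) by simp
  have "ecc_signless_laplacian G vs = k \<cdot>\<^sub>m 1\<^sub>m ?n + 1 \<cdot>\<^sub>m ?A"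
    unfolding ecc_signless_laplacian_def diag using A by (intro eq_matI) auto
  then have signless: "eigenvalue_mset (ecc_signless_laplacian G vs) = mset (map (\<lambda>x. k + x) \<xi>)"
    using eigenvalue_mset_affine[OF A sym, of k 1] assms(5) by simp
  have shifted: "2 * k # map (\<lambda>x. k + x) (tl \<xi>) = map (\<lambda>x. k + x) \<xi>"
    using hd ne by (cases \<xi>) auto

  show ?thesis
    unfolding shifted
  proof (intro conjI)
    show "sorted_wrt (\<ge>) (map (\<lambda>x. k - x) (rev \<xi>))"
      using assms(6) by (simp add: sorted_wrt_map sorted_wrt_rev)
    show "last (map (\<lambda>x. k - x) (rev \<xi>)) = 0"
      using ne hd by (simp add: last_map last_rev)
    show "sorted_wrt (\<ge>) (map (\<lambda>x. k + x) \<xi>)"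
      using assms(6) by (simp add: sorted_wrt_map)
  qed (use len card hd laplacian signless in simp_all)
qed

end
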